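(* Let $\chi_{1}=\mathbf{1}_{(-1,1)}$ be the characteristic function of the interval $(-1,1)$ on $\mathbb{R}$, and let \[ A_{\pi}(\chi_{1})_{1,1/2}=\inf_{F\in\mathcal{E}_{\pi,1,1/2}}\int_{\mathbb{R}}|\chi_{1}(x)-F(x)|\,|x|\,dx. \] Then \[ A_{\pi}(\chi_{1})_{1,1/2}=1. \]
   Context: $\mathcal{E}_{\pi,1,1/2}$ denotes the class of entire functions $F:\mathbb{C}\to\mathbb{C}$ of exponential type at most $\pi$ whose restriction to $\mathbb{R}$ lies in $L^{1}(\mathbb{R},|x|\,dx)$. *)

theory Defs
  imports "HOL-Complex_Analysis.Complex_Analysis"
begin

definition exp_type_le :: "real \<Rightarrow> (complex \<Rightarrow> complex) \<Rightarrow> bool" where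
  "exp_type_le \<tau> F \<longleftrightarrow>
     (\<forall>\<epsilon>>0. \<exists>C. \<forall>z. norm (F z) \<le> C * exp ((\<tau> + \<epsilon>) * norm z))"

definition abs_measure :: "real measure" where
  "abs_measure = density lborel (\<lambda>x. ennreal \<bar>x\<bar>)"

definition exp_type_L1 :: "real \<Rightarrow> (complex \<Rightarrow> complex) set" where
  "exp_type_L1 \<tau> = {F. F holomorphic_on UNIV \<and> exp_type_le \<tau> F \<and>
     integrable abs_measure (\<lambda>x. F (complex_of_real x))}"

(* For f integrable with respect to abs_measure every integral below is that of an
   integrable function, and the set of values is nonempty (take F = 0) and bounded
   below by 0, so the real-valued infimum is the usual one. *)
definition best_approx_L1 :: "real \<Rightarrow> (real \<Rightarrow> real) \<Rightarrow> real" where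
  "best_approx_L1 \<tau> f =
     (INF F\<in>exp_type_L1 \<tau>.
        LINT x|abs_measure. norm (complex_of_real (f x) - F (complex_of_real x)))"

end

theory Submission
  imports Defs "HOL-Probability.Distributions"
begin

text \<open>
  The function $F = 0$ gives the value $\int_{-1}^{1} |x|\,dx = 1$, so the content is that no $F$
  does better. The duality argument uses the signature
  $\psi(x) = \mathrm{sgn}(x)\,\mathrm{sgn}(\sin \pi x)$, which has modulus at most 1 and equals 1
  almost everywhere on $(-1,1)$. Since $|x|\psi(x) = x\,\mathrm{sgn}(\sin \pi x)$, the weight turns $F$
  into $G(z) = zF(z)$, which is again entire of exponential type at most $\pi$ and is
  integrable for Lebesgue measure. If $\int G(x)\,\mathrm{sgn}(\sin \pi x)\,dx = 0$, then
  \[ \int |\chi_1 - F|\,|x|\,dx \ge \Bigl|\int (\chi_1 - F)\,\psi\,|x|\,dx\Bigr|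
     = \int_{-1}^{1} |x|\,dx = 1. \]

  The square wave has only the frequencies $\pm\pi, \pm 3\pi, \dots$, so its orthogonality to $G$
  rests on a Paley-Wiener fact: $\int G(x)e^{itx}\,dx = 0$ for $|t| \ge \pi$
  (\<open>fourier_integral_exp_type_eq_0\<close>). The proof goes through the Borel transform
  $B(w) = \sum_n G^{(n)}(0)\,w^{-n-1}$, which converges for $|w| > \pi$. Termwise integration
  identifies it with the Laplace transform of $G$ over the positive half-line for large real $w$;
  because $G$ is integrable, that Laplace transform is holomorphic on the whole right half-plane and
  continuous up to the imaginary axis, so by analytic continuation the two agree at $w = -it$,
  $|t| > \pi$ (\<open>laplace_eq_borel_transform_imaginary\<close>). In the same way the integral over
  the negative half-line is $-B(-it)$, and the two halves cancel. The case $|t| = \pi$ is a limit.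

  To pass from exponentials to the square wave without estimates on partial sums of its Fourier
  series, the series is summed by Abel's method: for $|z| < 1$ the odd powers sum to
  $\log(1+z) - \log(1-z)$, whose imaginary part is bounded by $\pi$ and tends to
  $\frac{\pi}{2}\mathrm{sgn}(\sin\theta)$ as $z \to e^{i\theta}$ radially
  (\<open>integral_square_wave_eq_0\<close>).
\<close>

section \<open>The Laplace transform on a half-line\<close>

definition laplace :: "(real \<Rightarrow> complex) \<Rightarrow> complex \<Rightarrow> complex" where
  "laplace g w = (LINT x:{0..}|lborel. exp (- w * of_real x) * g x)"

lemma set_integrable_laplace:
  assumes "integrable lborel g" "0 \<le> Re w"
  shows "set_integrable lborel {0..} (\<lambda>x. exp (- w * of_real x) * g x)"
  unfolding set_integrable_def
proof (rule Bochner_Integration.integrable_bound)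
  show "integrable lborel (\<lambda>x. norm (g x))"
    using assms by simp
  show "(\<lambda>x. indicat_real {0..} x *\<^sub>R (exp (- w * complex_of_real x) * g x)) \<in> borel_measurable lborel"
    using borel_measurable_integrable[OF assms(1)] by measurable
  show "AE x in lborel. norm (indicat_real {0..} x *\<^sub>R (exp (- w * complex_of_real x) * g x)) \<le> norm (norm (g x))"
    using assms(2) by (auto simp: indicator_def norm_mult intro!: mult_left_le_one_le)
qed

text \<open>Integrability of $g$ makes the truncated transforms over $[0,n]$, which are holomorphic by
  differentiation under the integral, converge uniformly on the whole half-plane: the error is at
  most the tail $\int_n^\infty |g|$.\<close>

lemma laplace_holomorphic:
  assumes cont: "continuous_on UNIV g" and int: "integrable lborel g"
  shows "laplace g holomorphic_on {w. 0 < Re w}"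
proof (rule holomorphic_uniform_sequence[where f = "\<lambda>n w. integral {0..real n} (\<lambda>x. exp (- w * of_real x) * g x)"])
  show "open {w. 0 < Re w}" by (simp add: open_halfspace_Re_gt)
  show "(\<lambda>w. integral {0..real n} (\<lambda>x. exp (- w * of_real x) * g x)) holomorphic_on {w. 0 < Re w}" for n
  proof -
    have "(\<lambda>w. integral (cbox 0 (real n)) (\<lambda>x. exp (- w * of_real x) * g x)) holomorphic_on {w. 0 < Re w}"
    proof (rule leibniz_rule_holomorphic[where fx = "\<lambda>w x. - of_real x * exp (- w * of_real x) * g x"])
      show "((\<lambda>w. exp (- w * of_real t) * g t) has_field_derivative - of_real t * exp (- w * of_real t) * g t) (at w within {w. 0 < Re w})" for w t
        by (auto intro!: derivative_eq_intros)
      show "(\<lambda>x. exp (- w * of_real x) * g x) integrable_on cbox 0 (real n)" for w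
        by (intro integrable_continuous continuous_intros continuous_on_subset[OF cont]) auto
      show "continuous_on ({w. 0 < Re w} \<times> cbox 0 (real n)) (\<lambda>(w, x). - of_real x * exp (- w * of_real x) * g x)"
        unfolding split_beta 
        by (intro continuous_intros continuous_on_compose2[OF cont]) auto
      show "convex {w. 0 < Re w}" by (simp add: convex_halfspace_Re_gt)
    qed
    then show ?thesis by simp
  qed
  fix w :: complex assume w: "w \<in> {w. 0 < Re w}"
  then obtain d where d: "0 < d" "cball w d \<subseteq> {w. 0 < Re w}"
    using open_contains_cball[of "{w. 0 < Re w}"] by (auto simp: open_halfspace_Re_gt)
  define T where "T n = (LINT x|lborel. indicator {real n..} x * norm (g x))" for n
  have [measurable]: "g \<in> borel_measurable borel"
    using borel_measurable_continuous_onI[OF cont] .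
  have Tlim: "T \<longlonglongrightarrow> (LINT (x::real)|lborel. 0)"
    unfolding T_def
  proof (rule integral_dominated_convergence[where w = "\<lambda>x. norm (g x)"])
    show "AE x in lborel. (\<lambda>i. indicat_real {real i..} x * norm (g x)) \<longlonglongrightarrow> 0"
    proof (rule AE_I2)
      fix x :: real
      have "eventually (\<lambda>i. indicat_real {real i..} x * norm (g x) = 0) sequentially"
        using eventually_gt_at_top[of "nat \<lceil>\<bar>x\<bar>\<rceil>"]
        by eventually_elim (simp add: indicator_def, linarith)
      then show "(\<lambda>i. indicat_real {real i..} x * norm (g x)) \<longlonglongrightarrow> 0"
        by (simp add: tendsto_eventually)
    qed
  qed (use int in \<open>auto simp: indicator_def\<close>)
  have intT: "integrable lborel (\<lambda>x. indicator {real n..} x * norm (g x))" for n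
    using int by (intro Bochner_Integration.integrable_bound[OF integrable_norm[OF int]]) (auto simp: indicator_def)
  have bound: "norm (integral {0..real n} (\<lambda>x. exp (- w * of_real x) * g x) - laplace g w) \<le> T n"
    if "0 < Re w" for n w
  proof -
    let ?f = "\<lambda>x. exp (- w * of_real x) * g x"
    have I: "set_integrable lborel {0..} ?f"
      using set_integrable_laplace[OF int] that by simp
    have I1: "set_integrable lborel {0..real n} ?f" and I2: "set_integrable lborel {real n<..} ?f"
      by (rule set_integrable_subset[OF I]; auto)+
    have split: "{0..} = {0..real n} \<union> {real n<..}" by auto
    have "laplace g w = (LINT x:{0..real n}|lborel. ?f x) + (LINT x:{real n<..}|lborel. ?f x)"
      unfolding laplace_def split by (rule set_integral_Un[OF _ I1 I2]) auto
    then have "norm (integral {0..real n} ?f - laplace g w) = norm (LINT x:{real n<..}|lborel. ?f x)"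
      using set_borel_integral_eq_integral(2)[OF I1] by (simp add: norm_minus_commute)
    also have "\<dots> \<le> T n"
      unfolding T_def set_lebesgue_integral_def
    proof (rule order_trans[OF integral_norm_bound integral_mono])
      show "integrable lborel (\<lambda>x. norm (indicat_real {real n<..} x *\<^sub>R ?f x))"
        using integrable_norm[OF I2[unfolded set_integrable_def]] .
      show "norm (indicat_real {real n<..} x *\<^sub>R ?f x) \<le> indicator {real n..} x * norm (g x)" for x
      proof (cases "real n < x")
        case True
        then have "0 \<le> x" by linarith
        then show ?thesis using True that by (auto simp: norm_mult intro!: mult_left_le_one_le)
      qed (auto simp: indicator_def)
    qed (use intT in auto)
    finally show ?thesis .
  qed
  have "uniform_limit (cball w d) (\<lambda>n w. integral {0..real n} (\<lambda>x. exp (- w * of_real x) * g x)) (laplace g) sequentially"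
  proof (rule uniform_limitI)
    fix e :: real assume "0 < e"
    then have "eventually (\<lambda>n. T n < e) sequentially"
      using Tlim by (auto intro: order_tendstoD)
    then show "\<forall>\<^sub>F n in sequentially. \<forall>x\<in>cball w d. dist (integral {0..real n} (\<lambda>xa. exp (- x * of_real xa) * g xa)) (laplace g x) < e"
    proof eventually_elim
      case (elim n)
      show ?case
      proof
        fix u assume "u \<in> cball w d"
        then have "0 < Re u" using d(2) by blast
        then show "dist (integral {0..real n} (\<lambda>x. exp (- u * of_real x) * g x)) (laplace g u) < e"
          using bound[of u n] elim unfolding dist_norm by linarith
      qed
    qed
  qed
  then show "\<exists>d>0. cball w d \<subseteq> {w. 0 < Re w} \<and> uniform_limit (cball w d) (\<lambda>n w. integral {0..real n} (\<lambda>x. exp (- w * of_real x) * g x)) (laplace g) sequentially"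
    using d by blast
qed

lemma laplace_tendsto_boundary:
  assumes int: "integrable lborel g" and s: "s \<longlonglongrightarrow> w" "\<And>n. 0 \<le> Re (s n)"
  shows "(\<lambda>n. laplace g (s n)) \<longlonglongrightarrow> laplace g w"
  unfolding laplace_def set_lebesgue_integral_def
proof (rule integral_dominated_convergence[where w = "\<lambda>x. norm (g x)"])
  have [measurable]: "g \<in> borel_measurable borel" using borel_measurable_integrable[OF int] by simp
  show "(\<lambda>x. indicat_real {0..} x *\<^sub>R (exp (- w * complex_of_real x) * g x)) \<in> borel_measurable lborel"
    "(\<lambda>x. indicat_real {0..} x *\<^sub>R (exp (- s n * complex_of_real x) * g x)) \<in> borel_measurable lborel" for n
    by measurable
  show "AE x in lborel. (\<lambda>n. indicat_real {0..} x *\<^sub>R (exp (- s n * complex_of_real x) * g x)) \<longlonglongrightarrow>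
      indicat_real {0..} x *\<^sub>R (exp (- w * complex_of_real x) * g x)"
    by (intro AE_I2 tendsto_intros s)
  show "AE x in lborel. norm (indicat_real {0..} x *\<^sub>R (exp (- s n * complex_of_real x) * g x)) \<le> norm (g x)" for n
    using s(2)[of n] by (auto simp: indicator_def norm_mult intro!: mult_left_le_one_le)
qed (use int in auto)

section \<open>The Borel transform of an entire function of exponential type\<close>

lemma has_integral_power_exp:
  fixes l :: real
  assumes "0 < l"
  shows "has_bochner_integral lborel (\<lambda>x. indicator {0..} x * (x ^ n / fact n * exp (- l * x))) (1 / l ^ Suc n)"
proof -
  have "has_bochner_integral lborel (\<lambda>x. erlang_density n l x) 1"
    using nn_integral_erlang_ith_moment[OF assms, of n 0] assms
    by (intro has_bochner_integral_nn_integral) (auto)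
  then have "has_bochner_integral lborel (\<lambda>x. 1 / l ^ Suc n * erlang_density n l x) (1 / l ^ Suc n * 1)"
    by (rule has_bochner_integral_mult_right)
  also have "(\<lambda>x. 1 / l ^ Suc n * erlang_density n l x) = (\<lambda>x. indicator {0..} x * (x ^ n / fact n * exp (- l * x)))"
    using assms by (auto simp: erlang_density_def indicator_def fun_eq_iff)
  finally show ?thesis by simp
qed

text \<open>Cauchy's inequality on the circle of radius $R$ gives
  $|G^{(n)}(0)|\,R^n/n! \le C e^{aR}$. Instead of optimising $R$, which would need Stirling's
  formula, both sides are multiplied by $e^{-lR}$ and integrated over $R > 0$.\<close>

lemma taylor_coeff_bound:
  assumes hol: "G holomorphic_on UNIV"
    and growth: "\<And>z. norm (G z) \<le> C * exp (a * norm z)" and "0 \<le> a" "a < l"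
  shows "norm ((deriv ^^ n) G 0) \<le> C / (l - a) * l ^ Suc n"
proof -
  let ?b = "norm ((deriv ^^ n) G 0)"
  have l: "0 < l" using assms by linarith
  have *: "?b * (R ^ n / fact n) \<le> C * exp (a * R)" if "0 < R" for R
  proof -
    have "?b \<le> fact n * (C * exp (a * R)) / R ^ n"
    proof (rule Cauchy_inequality[where r = R])
      show "norm (0 - x) = R \<Longrightarrow> norm (G x) \<le> C * exp (a * R)" for x
        using growth[of x] by auto
    qed (use that hol in \<open>auto intro: holomorphic_on_subset holomorphic_on_imp_continuous_on\<close>)
    then show ?thesis using that by (simp add: field_simps)
  qed
  have I1: "has_bochner_integral lborel (\<lambda>x. ?b * (indicator {0..} x * (x ^ n / fact n * exp (- l * x)))) (?b * (1 / l ^ Suc n))"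
    by (rule has_bochner_integral_mult_right[OF has_integral_power_exp[OF l]])
  have I2: "has_bochner_integral lborel (\<lambda>x. C * (indicator {0..} x * (x ^ 0 / fact 0 * exp (- (l - a) * x)))) (C * (1 / (l - a) ^ Suc 0))"
    by (rule has_bochner_integral_mult_right[OF has_integral_power_exp]) (use assms in simp)
  have "?b * (1 / l ^ Suc n) \<le> C * (1 / (l - a) ^ Suc 0)"
    unfolding has_bochner_integral_integral_eq[OF I1, symmetric] has_bochner_integral_integral_eq[OF I2, symmetric]
  proof (rule integral_mono_AE)
    show "AE x in lborel. ?b * (indicator {0..} x * (x ^ n / fact n * exp (- l * x)))
       \<le> C * (indicator {0..} x * (x ^ 0 / fact 0 * exp (- (l - a) * x)))"
      using AE_lborel_singleton[of 0]
    proof eventually_elim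
      case (elim x)
      show ?case
      proof (cases "0 < x")
        case True
        have "?b * (x ^ n / fact n) * exp (- l * x) \<le> C * exp (a * x) * exp (- l * x)"
          using *[OF True] by (rule mult_right_mono) simp
        also have "\<dots> = C * exp (- (l - a) * x)"
          by (simp add: mult_exp_exp algebra_simps)
        finally show ?thesis using True by (simp add: indicator_def)
      qed (use elim in \<open>auto simp: indicator_def\<close>)
    qed
  qed (use I1 I2 in \<open>simp_all add: has_bochner_integral_iff\<close>)
  then show ?thesis using l assms by (simp add: field_simps)
qed

definition borel_transform :: "(complex \<Rightarrow> complex) \<Rightarrow> complex \<Rightarrow> complex" where
  "borel_transform G w = (\<Sum>n. (deriv ^^ n) G 0 / w ^ Suc n)"

lemma borel_transform_summable:
  assumes hol: "G holomorphic_on UNIV"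
    and growth: "\<And>z. norm (G z) \<le> C * exp (a * norm z)" and a: "0 \<le> a" "a < norm w"
  shows "summable (\<lambda>n. norm ((deriv ^^ n) G 0 / w ^ Suc n))"
proof -
  \<comment> \<open>Any radius strictly between $a$ and $|w|$ gives a geometric majorant.\<close>
  define l where "l = (a + norm w) / 2"
  have l: "0 < l" "a < l" "l < norm w" using a by (auto simp: l_def)
  then have "summable (\<lambda>n. C / (l - a) * l / norm w * (l / norm w) ^ n)"
    by (intro summable_mult summable_geometric) (auto simp: divide_less_eq)
  moreover have "norm (norm ((deriv ^^ n) G 0 / w ^ Suc n)) \<le> C / (l - a) * l / norm w * (l / norm w) ^ n" for n
  proof -
    have "norm ((deriv ^^ n) G 0) / norm w ^ Suc n \<le> C / (l - a) * l ^ Suc n / norm w ^ Suc n"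
      by (intro divide_right_mono taylor_coeff_bound[OF hol growth]) (use a l in auto)
    then show ?thesis by (simp add: norm_divide norm_power norm_mult power_divide)
  qed
  ultimately show ?thesis by (rule summable_comparison_test'[where N = 0])
qed

lemma borel_transform_holomorphic:
  assumes hol: "G holomorphic_on UNIV"
    and growth: "\<And>z. norm (G z) \<le> C * exp (a * norm z)" and a: "0 < a"
  shows "borel_transform G holomorphic_on {w. a < norm w}"
proof -
  define P where "P u = (\<Sum>n. (deriv ^^ n) G 0 * u ^ n)" for u :: complex
  have sm: "summable (\<lambda>n. (deriv ^^ n) G 0 * inverse w ^ n)" if "a < norm w" for w :: complex
  proof -
    have "summable (\<lambda>n. w * ((deriv ^^ n) G 0 / w ^ Suc n))"
      using borel_transform_summable[OF hol growth _ that] a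
      by (intro summable_mult summable_norm_cancel[of "\<lambda>n. (deriv ^^ n) G 0 / w ^ Suc n"]) simp
    moreover have "w \<noteq> 0" using that a by auto
    ultimately show ?thesis by (simp add: divide_inverse power_inverse mult_ac)
  qed
  have P: "P holomorphic_on ball 0 (inverse a)"
  proof (rule power_series_holomorphic)
    fix u :: complex assume u: "u \<in> ball 0 (inverse a)"
    have "summable (\<lambda>n. (deriv ^^ n) G 0 * u ^ n)"
    proof (cases "u = 0")
      case False
      then have "a < norm (inverse u)" using less_imp_inverse_less[of "norm u" "inverse a"] u by (simp add: norm_inverse)
      from sm[OF this] show ?thesis by simp
    qed simp
    then show "(\<lambda>n. (deriv ^^ n) G 0 * (u - 0) ^ n) sums P u"
      unfolding P_def by (simp add: summable_sums)
  qed
  have image: "inverse ` {w. a < norm w} \<subseteq> ball (0::complex) (inverse a)"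
  proof
    fix u :: complex assume "u \<in> inverse ` {w. a < norm w}"
    then obtain w where "u = inverse w" "a < norm w" by blast
    then show "u \<in> ball 0 (inverse a)"
      using less_imp_inverse_less[of a "norm w"] a by (simp add: norm_inverse)
  qed
  have inv: "inverse holomorphic_on {w::complex. a < norm w}"
    by (rule holomorphic_on_inverse[OF holomorphic_on_ident]) (use a in auto)
  have
 "(\<lambda>w. inverse w * P (inverse w)) holomorphic_on {w. a < norm w}"
    using holomorphic_on_mult[OF inv holomorphic_on_compose_gen[OF inv P image]] by (simp only: o_def)
  moreover have "inverse w * P (inverse w) = borel_transform G w" if "a < norm w" for w
    unfolding P_def borel_transform_def
    by (subst suminf_mult[OF sm[OF that], symmetric]) (simp add: divide_inverse power_inverse mult_ac)
  ultimately show ?thesis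
    using holomorphic_cong[of "{w. a < norm w}" _ "\<lambda>w. inverse w * P (inverse w)" "borel_transform G"] by simp
qed

text \<open>For real $l > a$ the Taylor series of $G$ may be integrated term by term, because
  $\sum_n |G^{(n)}(0)|\,l^{-n-1}$ converges.\<close>

lemma laplace_eq_borel_transform_real:
  assumes hol: "G holomorphic_on UNIV"
    and growth: "\<And>z. norm (G z) \<le> C * exp (a * norm z)" and a: "0 < a" "a < l"
  shows "laplace (\<lambda>x. G (of_real x)) (of_real l) = borel_transform G (of_real l)"
proof -
  have l: "0 < l" using a by linarith
  define b where "b n = (deriv ^^ n) G 0" for n
  define k where "k n x = indicator {0..} x * (x ^ n / fact n * exp (- l * x))" for n :: nat and x :: real
  have k: "has_bochner_integral lborel (k n) (1 / l ^ Suc n)" for n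
    unfolding k_def by (rule has_integral_power_exp[OF l])
  have k0: "0 \<le> k n x" for n x
    by (auto simp: k_def indicator_def)
  define f where "f n x = k n x *\<^sub>R b n" for n x
  have f: "has_bochner_integral lborel (f n) ((1 / l ^ Suc n) *\<^sub>R b n)" for n
    unfolding f_def by (rule has_bochner_integral_scaleR_left[OF k])
  have nf: "has_bochner_integral lborel (\<lambda>x. norm (f n x)) ((1 / l ^ Suc n) * norm (b n))" for n
    unfolding f_def using has_bochner_integral_mult_left[OF k] k0 by simp
  have sums: "(\<lambda>n. f n x) sums (indicat_real {0..} x *\<^sub>R (exp (- of_real l * of_real x) * G (of_real x)))" for x
  proof -
    have "(\<lambda>n. (deriv ^^ n) G 0 / fact n * (of_real x - 0) ^ n) sums G (of_real x)"
      by (rule holomorphic_power_series[where r = "\<bar>x\<bar> + 1"]) (use hol in \<open>auto intro: holomorphic_on_subset\<close>)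
    then have "(\<lambda>n. indicat_real {0..} x *\<^sub>R (exp (- of_real l * of_real x) * ((deriv ^^ n) G 0 / fact n * (of_real x - 0) ^ n)))
      sums (indicat_real {0..} x *\<^sub>R (exp (- of_real l * of_real x) * G (of_real x)))"
      by (intro sums_scaleR_right sums_mult)
    also have "(\<lambda>n. indicat_real {0..} x *\<^sub>R (exp (- of_real l * of_real x) * ((deriv ^^ n) G 0 / fact n * (of_real x - 0) ^ n))) = (\<lambda>n. f n x)"
      by (simp add: fun_eq_iff f_def k_def b_def scaleR_conv_of_real field_simps flip: exp_of_real)
    finally show ?thesis .
  qed
  have "(\<lambda>n. integral\<^sup>L lborel (f n)) sums (\<integral>x. (\<Sum>n. f n x) \<partial>lborel)"
  proof (rule sums_integral)
    show "integrable lborel (f n)" for n using f by (simp add: has_bochner_integral_iff)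
    show "AE x in lborel. summable (\<lambda>i. norm (f i x))"
    proof (rule AE_I2)
      fix x
      show "summable (\<lambda>i. norm (f i x))"
      proof -
        \<comment> \<open>Absolute convergence at $x$ from convergence at a point of larger modulus.\<close>
        have "summable (\<lambda>n. norm ((deriv ^^ n) G 0 / fact n * (of_real x) ^ n))"
        proof (rule powser_insidea[where x = "of_real (\<bar>x\<bar> + 1)"])
          have "(\<lambda>n. (deriv ^^ n) G 0 / fact n * (of_real (\<bar>x\<bar> + 1) - 0) ^ n) sums G (of_real (\<bar>x\<bar> + 1))"
            by (rule holomorphic_power_series[where r = "\<bar>x\<bar> + 2"]) (use hol in \<open>auto intro: holomorphic_on_subset simp del: of_real_add\<close>)
          then show "summable (\<lambda>n. (deriv ^^ n) G 0 / fact n * (of_real (\<bar>x\<bar> + 1)) ^ n)"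
            by (simp add: sums_iff)
        qed (simp del: of_real_add)
        then have "summable (\<lambda>n. (indicat_real {0..} x * exp (- l * x)) * norm ((deriv ^^ n) G 0 / fact n * (of_real x) ^ n))"
          by (rule summable_mult)
        also have "(\<lambda>n. (indicat_real {0..} x * exp (- l * x)) * norm ((deriv ^^ n) G 0 / fact n * (of_real x) ^ n)) = (\<lambda>n. norm (f n x))"
          by (simp add: fun_eq_iff f_def k_def b_def norm_mult norm_divide norm_power field_simps indicator_def)
        finally show ?thesis .
      qed
    qed
    have "summable (\<lambda>n. norm ((deriv ^^ n) G 0 / of_real l ^ Suc n))"
      by (rule borel_transform_summable[OF hol growth]) (use a l in auto)
    then show "summable (\<lambda>i. LINT x|lborel. norm (f i x))"
      using l by (simp add: has_bochner_integral_integral_eq[OF nf] b_def norm_divide norm_mult norm_power)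
  qed
  moreover have "integral\<^sup>L lborel (f n) = (deriv ^^ n) G 0 / of_real l ^ Suc n" for n
    by (simp add: has_bochner_integral_integral_eq[OF f] b_def scaleR_conv_of_real)
  moreover have "(\<integral>x. (\<Sum>n. f n x) \<partial>lborel) = laplace (\<lambda>x. G (of_real x)) (of_real l)"
    unfolding laplace_def set_lebesgue_integral_def using sums by (simp add: sums_iff)
  ultimately show ?thesis unfolding borel_transform_def by (simp add: sums_iff)
qed

text \<open>Analytic continuation from the ray $(a,\infty)$. The Borel transform lives on $|w| > a$ and the
  Laplace transform on $\mathrm{Re}\,w > 0$; the continuation runs through the half-plane
  $\mathrm{Re}\,w > a$ and a quadrant above or below the strip $|\mathrm{Im}\,w| \le a$. The union of
  these two convex sets lies in both domains and is connected.\<close>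

lemma laplace_eq_borel_transform:
  assumes hol: "G holomorphic_on UNIV"
    and growth: "\<And>z. norm (G z) \<le> C * exp (a * norm z)" and a: "0 < a"
    and int: "integrable lborel (\<lambda>x. G (of_real x))"
    and w: "0 < Re w" "a < \<bar>Im w\<bar>"
  shows "laplace (\<lambda>x. G (of_real x)) w = borel_transform G w"
proof -
  have *: "laplace (\<lambda>x. G (of_real x)) w = borel_transform G w"
    if w: "0 < Re w" "w \<in> H" and H: "H = {w. a < Im w} \<or> H = {w. Im w < - a}" for w H
  proof -
    define S where "S = {w. 0 < Re w} \<inter> H \<union> {w. a < Re w}"
    have "open H" "convex H"
      using H by (auto simp: open_halfspace_Im_gt open_halfspace_Im_lt convex_halfspace_Im_gt convex_halfspace_Im_lt)
    have "Complex (a + 1) (a + 1) \<in> H \<or> Complex (a + 1) (- a - 1) \<in> H"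
      using H by auto
    then obtain c where "Complex (a + 1) c \<in> H" by blast
    with a have "Complex (a + 1) c \<in> ({w. 0 < Re w} \<inter> H) \<inter> {w. a < Re w}" by simp
    then have "({w. 0 < Re w} \<inter> H) \<inter> {w. a < Re w} \<noteq> {}" by blast
    then have "connected S"
      unfolding S_def using \<open>convex H\<close>
      by (intro connected_Un convex_connected convex_Int convex_halfspace_Re_gt)
    have S: "S \<subseteq> {w. 0 < Re w}" "S \<subseteq> {w. a < norm w}"
    proof -
      show "S \<subseteq> {w. 0 < Re w}" using a by (auto simp: S_def)
      have "a < norm u" if "u \<in> S" for u
        using that H a abs_Re_le_cmod[of u] abs_Im_le_cmod[of u] unfolding S_def by auto
      then show "S \<subseteq> {w. a < norm w}" by blast
    qed
    have "laplace (\<lambda>x. G (of_real x)) w - borel_transform G w = 0"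
    proof (rule analytic_continuation[where S = S and U = "of_real ` {a<..}" and \<xi> = "of_real (a + 1)"
          and f = "\<lambda>w. laplace (\<lambda>x. G (of_real x)) w - borel_transform G w"])
      have "continuous_on UNIV (\<lambda>x::real. G (of_real x))"
        by (rule continuous_on_compose2[OF holomorphic_on_imp_continuous_on[OF hol]])
           (auto intro: continuous_intros)
      from laplace_holomorphic[OF this int]
      show "(\<lambda>w. laplace (\<lambda>x. G (of_real x)) w - borel_transform G w) holomorphic_on S"
        using borel_transform_holomorphic[OF hol growth a] S
        by (blast intro: holomorphic_on_diff holomorphic_on_subset)
      show "open S"
        unfolding S_def using \<open>open H\<close> by (intro open_Un open_Int open_halfspace_Re_gt)
      show "complex_of_real (a + 1) islimpt of_real ` {a<..}"
        unfolding islimpt_approachable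
      proof (intro allI impI)
        fix e :: real assume "0 < e"
        then show "\<exists>x'\<in>of_real ` {a<..}. x' \<noteq> complex_of_real (a + 1) \<and> dist x' (of_real (a + 1)) < e"
          by (intro bexI[of _ "of_real (a + 1 + e / 2)"])
             (auto simp: dist_norm simp flip: of_real_diff simp del: of_real_add)
      qed
      show "laplace (\<lambda>x. G (of_real x)) u - borel_transform G u = 0" if "u \<in> of_real ` {a<..}" for u
        using that laplace_eq_borel_transform_real[OF hol growth a] by auto
      show "of_real ` {a<..} \<subseteq> S" "of_real (a + 1) \<in> S"
        using a by (auto simp: S_def)
      show "w \<in> S" using w by (simp add: S_def)
    qed fact
    then show ?thesis by simp
  qed
  show ?thesis
    using *[of w "{w. a < Im w}"] *[of w "{w. Im w < - a}"] w by (cases "0 \<le> Im w") auto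
qed

lemma laplace_eq_borel_transform_imaginary:
  assumes hol: "G holomorphic_on UNIV"
    and growth: "\<And>z. norm (G z) \<le> C * exp (a * norm z)" and a: "0 < a"
    and int: "integrable lborel (\<lambda>x. G (of_real x))"
    and t: "a < \<bar>t\<bar>"
  shows "laplace (\<lambda>x. G (of_real x)) (\<i> * of_real t) = borel_transform G (\<i> * of_real t)"
proof (rule LIMSEQ_unique)
  define s where "s n = of_real (inverse (real (Suc n))) + \<i> * of_real t" for n
  have "s \<longlonglongrightarrow> of_real 0 + \<i> * of_real t"
    unfolding s_def by (intro tendsto_intros LIMSEQ_inverse_real_of_nat)
  then have s: "s \<longlonglongrightarrow> \<i> * of_real t" by simp
  show "(\<lambda>n. laplace (\<lambda>x. G (of_real x)) (s n)) \<longlonglongrightarrow> laplace (\<lambda>x. G (of_real x)) (\<i> * of_real t)"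
    by (rule laplace_tendsto_boundary[OF int s]) (simp add: s_def)
  have "open {w::complex. a < norm w}"
    by (intro open_Collect_less continuous_intros)
  then have "isCont (borel_transform G) (\<i> * of_real t)"
    using holomorphic_on_imp_continuous_on[OF borel_transform_holomorphic[OF hol growth a]] t
    by (auto simp: continuous_on_eq_continuous_at norm_mult)
  then have "(\<lambda>n. borel_transform G (s n)) \<longlonglongrightarrow> borel_transform G (\<i> * of_real t)"
    using s by (rule isCont_tendsto_compose)
  moreover have "laplace (\<lambda>x. G (of_real x)) (s n) = borel_transform G (s n)" for n
    by (rule laplace_eq_borel_transform[OF hol growth a int]) (use t in \<open>auto simp: s_def\<close>)
  ultimately show "(\<lambda>n. laplace (\<lambda>x. G (of_real x)) (s n)) \<longlonglongrightarrow> borel_transform G (\<i> * of_real t)"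
    by simp
qed

section \<open>Vanishing of the Fourier transform outside the type\<close>

lemma integral_eq_half_lines:
  fixes h :: "real \<Rightarrow> complex"
  assumes int: "integrable lborel h"
  shows "(LINT x|lborel. h x) = (LINT x:{0..}|lborel. h x) + (LINT x:{0..}|lborel. h (- x))"
proof -
  let ?p = "\<lambda>x. indicat_real {0..} x *\<^sub>R h x" and ?n = "\<lambda>x. indicat_real {0..} (- x) *\<^sub>R h x"
  have [measurable]: "h \<in> borel_measurable borel" using borel_measurable_integrable[OF int] by simp
  have ip: "integrable lborel ?p" and im: "integrable lborel ?n"
    by (rule Bochner_Integration.integrable_bound[OF int]; auto simp: indicator_def)+
  have "(LINT x|lborel. h x) = (LINT x|lborel. ?p x + ?n x)"
  proof (rule integral_cong_AE)
    show "AE x in lborel. h x = ?p x + ?n x"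
      using AE_lborel_singleton[of 0] by eventually_elim (auto simp: indicator_def)
  qed auto
  also have "\<dots> = (LINT x|lborel. ?p x) + (LINT x|lborel. ?n x)"
    using ip im by (rule Bochner_Integration.integral_add)
  also have "(LINT x|lborel. ?n x) = (LINT x|lborel. indicat_real {0..} x *\<^sub>R h (- x))"
    using lborel_integral_real_affine[of "-1" ?n 0] by simp
  finally show ?thesis by (simp add: set_lebesgue_integral_def)
qed

text \<open>The two half-lines contribute the Borel transform of $G$ at $-it$ and that of the reflected
  function $G(-z)$ at $it$. The latter is the negative of the former, since reflection multiplies the
  $n$-th coefficient by $(-1)^n$ and the powers of $w$ in the series are $w^{-n-1}$.\<close>

lemma fourier_integral_eq_0:
  assumes hol: "G holomorphic_on UNIV"
    and growth: "\<And>z. norm (G z) \<le> C * exp (a * norm z)" and a: "0 < a"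
    and int: "integrable lborel (\<lambda>x. G (of_real x))"
    and t: "a < \<bar>t\<bar>"
  shows "(LINT x|lborel. exp (\<i> * of_real (t * x)) * G (of_real x)) = 0"
proof -
  define G' where "G' z = G (- z)" for z
  have hol': "G' holomorphic_on UNIV"
    unfolding G'_def using holomorphic_on_compose_gen[of uminus UNIV G UNIV] hol
    by (simp add: o_def holomorphic_on_minus)
  have growth': "norm (G' z) \<le> C * exp (a * norm z)" for z
    using growth[of "- z"] by (simp add: G'_def)
  have int': "integrable lborel (\<lambda>x. G' (of_real x))"
    using lborel_integrable_real_affine[OF int, of "-1" 0] by (simp add: G'_def)
  have deriv': "(deriv ^^ n) G' 0 = (-1) ^ n * (deriv ^^ n) G 0" for n
    using higher_deriv_compose_linear[OF hol open_UNIV open_UNIV, of 0 "-1" n] by (simp add: G'_def[abs_def])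
  have "integrable lborel (\<lambda>x. exp (\<i> * of_real (t * x)) * G (of_real x))"
  proof (rule Bochner_Integration.integrable_bound[OF int])
    show "(\<lambda>x. exp (\<i> * of_real (t * x)) * G (of_real x)) \<in> borel_measurable lborel"
      using borel_measurable_integrable[OF int] by measurable
  qed (simp add: norm_mult)
  then have "(LINT x|lborel. exp (\<i> * of_real (t * x)) * G (of_real x)) =
      laplace (\<lambda>x. G (of_real x)) (\<i> * of_real (- t)) + laplace (\<lambda>x. G' (of_real x)) (\<i> * of_real t)"
    by (subst integral_eq_half_lines) (simp_all add: laplace_def G'_def mult_ac)
  also have "\<dots> = borel_transform G (\<i> * of_real (- t)) + borel_transform G' (\<i> * of_real t)"
    using laplace_eq_borel_transform_imaginary[OF hol growth a int, of "- t"]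
      laplace_eq_borel_transform_imaginary[OF hol' growth' a int' t] t by simp
  also have "borel_transform G' (\<i> * of_real t) = (\<Sum>n. - ((deriv ^^ n) G 0 / (\<i> * of_real (- t)) ^ Suc n))"
    unfolding borel_transform_def deriv'
    by (rule suminf_cong) (simp add: power_mult_distrib power_minus' field_simps uminus_power_if)
  also have "\<dots> = - borel_transform G (\<i> * of_real (- t))"
    unfolding borel_transform_def
    by (intro suminf_minus summable_norm_cancel[OF borel_transform_summable[OF hol growth]])
       (use a t in \<open>auto simp: norm_mult\<close>)
  finally show ?thesis by simp
qed

text \<open>The growth hypothesis gives a bound of order $e^{(\tau+\varepsilon)|z|}$ for every $\varepsilon > 0$, which
  settles $|t| > \tau$; the endpoint follows by continuity of the Fourier transform of an integrable
  function.\<close>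
lemma fourier_integral_exp_type_eq_0:
  assumes hol: "G holomorphic_on UNIV" and "exp_type_le \<tau> G" and \<tau>: "0 < \<tau>"
    and int: "integrable lborel (\<lambda>x. G (of_real x))"
    and t: "\<tau> \<le> \<bar>t\<bar>"
  shows "(LINT x|lborel. exp (\<i> * of_real (t * x)) * G (of_real x)) = 0"
proof -
  have [measurable]: "(\<lambda>x. G (of_real x)) \<in> borel_measurable borel"
    using borel_measurable_integrable[OF int] by simp
  have strict: "(LINT x|lborel. exp (\<i> * of_real (s * x)) * G (of_real x)) = 0" if "\<tau> < \<bar>s\<bar>" for s
  proof -
    from that obtain \<epsilon> where \<epsilon>: "0 < \<epsilon>" "\<tau> + \<epsilon> < \<bar>s\<bar>"
      using dense[of 0 "\<bar>s\<bar> - \<tau>"] by auto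
    then obtain C where "norm (G z) \<le> C * exp ((\<tau> + \<epsilon>) * norm z)" for z
      using \<open>exp_type_le \<tau> G\<close> unfolding exp_type_le_def by blast
    from fourier_integral_eq_0[OF hol this _ int \<epsilon>(2)] show ?thesis
      using \<epsilon>(1) \<tau> by simp
  qed
  \<comment> \<open>Approach $t$ from outside, so that every $|s_n|$ exceeds the type.\<close>
  define s where "s n = t * (1 + inverse (real (Suc n)))" for n
  have "s \<longlonglongrightarrow> t * (1 + 0)"
    unfolding s_def by (intro tendsto_intros LIMSEQ_inverse_real_of_nat)
  then have s_lim: "s \<longlonglongrightarrow> t" by simp
  have s: "\<tau> < \<bar>s n\<bar>" for n
  proof -
    have "\<bar>t\<bar> * 1 < \<bar>t\<bar> * (1 + inverse (real (Suc n)))"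
      using t \<tau> by (intro mult_strict_left_mono) auto
    also have "\<dots> = \<bar>s n\<bar>" by (simp add: s_def abs_mult)
    finally show ?thesis using t by simp
  qed
  have "(\<lambda>n. LINT x|lborel. exp (\<i> * of_real (s n * x)) * G (of_real x)) \<longlonglongrightarrow>
      (LINT x|lborel. exp (\<i> * of_real (t * x)) * G (of_real x))"
  proof (rule integral_dominated_convergence[where w = "\<lambda>x. norm (G (of_real x))"])
    show "AE x in lborel. (\<lambda>n. exp (\<i> * of_real (s n * x)) * G (of_real x)) \<longlonglongrightarrow> exp (\<i> * of_real (t * x)) * G (of_real x)"
      by (intro AE_I2 tendsto_intros s_lim)
  qed (use int in \<open>auto simp: norm_mult\<close>)
  then show ?thesis
    using strict[OF s] by (simp add: LIMSEQ_const_iff)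
qed

section \<open>Orthogonality to the square wave\<close>

text \<open>Twice the inverse hyperbolic tangent, written with principal logarithms: for $|z| < 1$ both
  arguments lie in the right half-plane, which keeps the imaginary part bounded.\<close>
definition log_quotient :: "complex \<Rightarrow> complex" where
  "log_quotient z = Ln (1 + z) - Ln (1 - z)"

lemma log_quotient_sums:
  assumes "norm z < 1"
  shows "(\<lambda>n. of_real ((1 - (-1) ^ n) / real n) * z ^ n) sums log_quotient z"
proof -
  have "(\<lambda>n. (-1) ^ Suc n / of_nat n * z ^ n - (-1) ^ Suc n / of_nat n * (- z) ^ n) sums (Ln (1 + z) - Ln (1 + - z))"
    by (intro sums_diff Ln_series) (use assms in auto)
  also have "(\<lambda>n. (-1) ^ Suc n / of_nat n * z ^ n - (-1) ^ Suc n / of_nat n * (- z) ^ n) =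
      (\<lambda>n. of_real ((1 - (-1) ^ n) / real n) * z ^ n)"
    by (auto simp: fun_eq_iff uminus_power_if)
  finally show ?thesis by (simp add: log_quotient_def)
qed

lemma
  assumes "norm z < 1"
  shows Re_one_plus_pos: "0 < Re (1 + z)" and Re_one_minus_pos: "0 < Re (1 - z)"
  using abs_Re_le_cmod[of z] assms by auto

lemma Im_log_quotient_bound:
  assumes "norm z < 1"
  shows "\<bar>Im (log_quotient z)\<bar> \<le> pi"
  using Re_Ln_pos_lt_imp[OF Re_one_plus_pos[OF assms]] Re_Ln_pos_lt_imp[OF Re_one_minus_pos[OF assms]]
  by (simp add: log_quotient_def)

lemma cnj_log_quotient:
  assumes "norm z < 1"
  shows "cnj (log_quotient z) = log_quotient (cnj z)"
  using cnj_Ln[of "1 + z"] cnj_Ln[of "1 - z"] Re_one_plus_pos[OF assms] Re_one_minus_pos[OF assms]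
  by (auto simp: log_quotient_def complex_nonpos_Reals_iff)

lemma
  fixes \<theta> :: real
  assumes "sin \<theta> \<noteq> 0"
  shows cos_less_one: "cos \<theta> < 1" and minus_one_less_cos: "- 1 < cos \<theta>"
proof -
  have "1 - cos \<theta> ^ 2 \<noteq> 0" using assms by (simp flip: sin_squared_eq)
  then have "cos \<theta> \<noteq> 1" "cos \<theta> \<noteq> - 1" by auto
  then show "cos \<theta> < 1" "- 1 < cos \<theta>"
    using cos_le_one[of \<theta>] cos_ge_minus_one[of \<theta>] by linarith+
qed

text \<open>On the unit circle $(1+e^{i\theta})/(1-e^{i\theta}) = i\cot(\theta/2)$ is purely imaginary; the two
  arguments are $\arctan p$ and $-\arctan(1/p)$ with $p = \tan(\theta/2)$.\<close>

lemma Im_log_quotient_cis: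
  assumes "sin \<theta> \<noteq> 0"
  shows "Im (log_quotient (cis \<theta>)) = pi / 2 * sgn (sin \<theta>)"
proof -
  note c = cos_less_one[OF assms] minus_one_less_cos[OF assms]
  define p where "p = sin \<theta> / (1 + cos \<theta>)"
  have p: "p \<noteq> 0" "sgn p = sgn (sin \<theta>)"
    using assms c by (auto simp: p_def sgn_if field_simps)
  have "sin \<theta> * sin \<theta> = (1 - cos \<theta>) * (1 + cos \<theta>)"
    using sin_squared_eq[of \<theta>] by (simp add: power2_eq_square algebra_simps)
  then have inv: "1 / p = sin \<theta> / (1 - cos \<theta>)"
    using c assms by (simp add: p_def field_simps)
  have "1 + cis \<theta> \<noteq> 0" "1 - cis \<theta> \<noteq> 0"
    using c by (auto simp: complex_eq_iff)
  then have "Im (Ln (1 + cis \<theta>)) = arctan p" "Im (Ln (1 - cis \<theta>)) = - arctan (sin \<theta> / (1 - cos \<theta>))"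
    using c by (simp_all add: Im_Ln_eq p_def arctan_minus flip: minus_divide_left)
  then show ?thesis
    using Transcendental.arctan_inverse[OF p(1)] p(2) by (simp add: log_quotient_def inv)
qed

text \<open>The damping factor $r < 1$ makes the series of \<open>log_quotient\<close> absolutely convergent, so
  it can be integrated termwise. Its constant term is zero, which is why only the positive multiples of
  $c$ have to be annihilated by $g$.\<close>

lemma integral_log_quotient_eq_0:
  fixes g :: "real \<Rightarrow> complex"
  assumes int: "integrable lborel g" and r: "0 \<le> r" "r < 1"
    and zero: "\<And>n. 0 < n \<Longrightarrow> (LINT x|lborel. exp (\<i> * of_real (real n * c * x)) * g x) = 0"
  shows "integrable lborel (\<lambda>x. log_quotient (of_real r * cis (c * x)) * g x)"
    and "(LINT x|lborel. log_quotient (of_real r * cis (c * x)) * g x) = 0"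
proof -
  have [measurable]: "g \<in> borel_measurable borel" using borel_measurable_integrable[OF int] by simp
  define d where "d n = (1 - (-1) ^ n) / real n * r ^ n" for n
  define f where "f n x = of_real (d n) * (exp (\<i> * of_real (real n * c * x)) * g x)" for n x
  have d: "\<bar>d n\<bar> \<le> 2 * r ^ n" for n
  proof (cases "n = 0")
    case False
    then have "\<bar>(1 - (-1) ^ n) / real n\<bar> \<le> 2"
      by (auto simp: uminus_power_if divide_le_eq)
    then have "\<bar>(1 - (-1) ^ n) / real n\<bar> * r ^ n \<le> 2 * r ^ n"
      using r by (intro mult_right_mono) auto
    then show ?thesis using r by (simp only: d_def abs_mult power_abs abs_of_nonneg)
  qed (simp add: d_def)
  have sd: "summable (\<lambda>n. \<bar>d n\<bar> * K)" for K
  proof (rule summable_mult2, rule summable_comparison_test')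
    show "summable (\<lambda>n. 2 * r ^ n)" using r by (intro summable_mult summable_geometric) auto
    show "norm \<bar>d n\<bar> \<le> 2 * r ^ n" if "n \<ge> 0" for n using d by simp
  qed
  have norm_f: "norm (f n x) = \<bar>d n\<bar> * norm (g x)" for n x
    by (simp add: f_def norm_mult)
  have int_e: "integrable lborel (\<lambda>x. exp (\<i> * of_real (real n * c * x)) * g x)" for n
    by (rule Bochner_Integration.integrable_bound[OF int]) (auto simp: norm_mult)
  have int_f: "integrable lborel (f n)" for n
    unfolding f_def by (rule integrable_mult_right[OF int_e])
  have sums: "(\<lambda>n. f n x) sums (log_quotient (of_real r * cis (c * x)) * g x)" for x
  proof -
    have "(\<lambda>n. of_real ((1 - (-1) ^ n) / real n) * (of_real r * cis (c * x)) ^ n * g x) sums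
        (log_quotient (of_real r * cis (c * x)) * g x)"
      by (rule sums_mult2[OF log_quotient_sums]) (use r in \<open>auto simp: norm_mult\<close>)
    also have "(\<lambda>n. of_real ((1 - (-1) ^ n) / real n) * (of_real r * cis (c * x)) ^ n * g x) = (\<lambda>n. f n x)"
    proof
      fix n
      have "cis (c * x) ^ n = exp (\<i> * of_real (real n * c * x))"
        unfolding Complex.DeMoivre unfolding cis_conv_exp by (simp only: mult.assoc)
      then show "of_real ((1 - (-1) ^ n) / real n) * (of_real r * cis (c * x)) ^ n * g x = f n x"
        by (simp add: f_def d_def power_mult_distrib)
    qed
    finally show ?thesis .
  qed
  have sn: "summable (\<lambda>n. norm (f n x))" for x
    using sd by (simp add: norm_f)
  have si: "summable (\<lambda>n. LINT x|lborel. norm (f n x))"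
    using sd by (simp add: norm_f)
  have eq: "(\<Sum>n. f n x) = log_quotient (of_real r * cis (c * x)) * g x" for x
    using sums by (simp add: sums_iff)
  have int_f_0: "integral\<^sup>L lborel (f n) = 0" for n
    using zero[of n] by (cases "n = 0") (auto simp: f_def[abs_def] d_def)
  show "integrable lborel (\<lambda>x. log_quotient (of_real r * cis (c * x)) * g x)"
    using integrable_suminf[OF int_f AE_I2[OF sn] si] by (simp add: eq)
  show "(LINT x|lborel. log_quotient (of_real r * cis (c * x)) * g x) = 0"
    using sums_integral[OF int_f AE_I2[OF sn] si] by (simp add: eq int_f_0 sums_iff)
qed

text \<open>Taking $c = \pi$ and $c = -\pi$ in the previous lemma isolates the imaginary part of
  \<open>log_quotient\<close> for complex-valued $g$; then $r \to 1$ by dominated convergence.\<close>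

lemma integral_square_wave_eq_0:
  fixes g :: "real \<Rightarrow> complex"
  assumes int: "integrable lborel g"
    and zero: "\<And>t. pi \<le> \<bar>t\<bar> \<Longrightarrow> (LINT x|lborel. exp (\<i> * of_real (t * x)) * g x) = 0"
  shows "(LINT x|lborel. of_real (sgn (sin (pi * x))) * g x) = 0"
proof -
  have [measurable]: "g \<in> borel_measurable borel" using borel_measurable_integrable[OF int] by simp
  define r where "r n = 1 - inverse (real (Suc n))" for n
  have r: "0 \<le> r n" "r n < 1" for n
    by (auto simp: r_def field_simps)
  have r_lim: "r \<longlonglongrightarrow> 1"
    unfolding r_def using tendsto_diff[OF tendsto_const LIMSEQ_inverse_real_of_nat, of "1::real"] by simp
  have *: "integrable lborel (\<lambda>x. log_quotient (of_real (r n) * cis (c * x)) * g x)"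
    "(LINT x|lborel. log_quotient (of_real (r n) * cis (c * x)) * g x) = 0"
    if "\<bar>c\<bar> = pi" for n c
  proof -
    have "pi \<le> \<bar>real m * c\<bar>" if "0 < m" for m
      using \<open>\<bar>c\<bar> = pi\<close> that by (simp add: abs_mult)
    then show "integrable lborel (\<lambda>x. log_quotient (of_real (r n) * cis (c * x)) * g x)"
      "(LINT x|lborel. log_quotient (of_real (r n) * cis (c * x)) * g x) = 0"
      by (intro integral_log_quotient_eq_0[OF int r] zero; simp)+
  qed
  have Im_0: "(LINT x|lborel. of_real (Im (log_quotient (of_real (r n) * cis (pi * x)))) * g x) = 0" for n
  proof -
    have "of_real (Im (log_quotient (of_real (r n) * cis (pi * x)))) * g x =
        (log_quotient (of_real (r n) * cis (pi * x)) * g x - log_quotient (of_real (r n) * cis (- pi * x)) * g x) / (2 * \<i>)" for x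
    proof -
      have "log_quotient (of_real (r n) * cis (- pi * x)) = cnj (log_quotient (of_real (r n) * cis (pi * x)))"
        using r[of n] by (subst cnj_log_quotient) (auto simp: norm_mult cis_cnj)
      then show ?thesis
        using complex_diff_cnj[of "log_quotient (of_real (r n) * cis (pi * x))"]
        by (simp only: flip: left_diff_distrib) (simp add: mult_ac)
    qed
    then show ?thesis
      using *[of pi n] *[of "- pi" n] by simp
  qed
  have "(\<lambda>n. LINT x|lborel. of_real (Im (log_quotient (of_real (r n) * cis (pi * x)))) * g x) \<longlonglongrightarrow>
      (LINT x|lborel. of_real (pi / 2 * sgn (sin (pi * x))) * g x)"
  proof (rule integral_dominated_convergence[where w = "\<lambda>x. pi * norm (g x)"])
    show "(\<lambda>x. of_real (Im (log_quotient (of_real (r n) * cis (pi * x)))) * g x) \<in> borel_measurable lborel" for n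
    proof -
      have "(\<lambda>x. Im (log_quotient (of_real (r n) * cis (pi * x)))) \<in> borel_measurable borel"
        unfolding log_quotient_def cis_conv_exp by measurable
      then show ?thesis by measurable
    qed
    show "AE x in lborel. (\<lambda>n. of_real (Im (log_quotient (of_real (r n) * cis (pi * x)))) * g x) \<longlonglongrightarrow>
        of_real (pi / 2 * sgn (sin (pi * x))) * g x"
      using AE_not_in[OF countable_imp_null_set_lborel[OF countable_int]]
    proof eventually_elim
      case (elim x)
      have s: "sin (pi * x) \<noteq> 0"
        using elim by (auto simp: sin_zero_iff_int2)
      have "(\<lambda>n. log_quotient (of_real (r n) * cis (pi * x))) \<longlonglongrightarrow> log_quotient (of_real 1 * cis (pi * x))"
        unfolding log_quotient_def
        by (intro tendsto_intros r_lim)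
           (use cos_less_one[OF s] minus_one_less_cos[OF s] in \<open>auto simp: complex_nonpos_Reals_iff\<close>)
      from tendsto_Im[OF this]
      have "(\<lambda>n. Im (log_quotient (of_real (r n) * cis (pi * x)))) \<longlonglongrightarrow> pi / 2 * sgn (sin (pi * x))"
        by (simp only: of_real_1 mult_1_left Im_log_quotient_cis[OF s])
      then show ?case by (intro tendsto_intros)
    qed
    show "AE x in lborel. norm (of_real (Im (log_quotient (of_real (r n) * cis (pi * x)))) * g x) \<le> pi * norm (g x)" for n
      using r[of n] by (intro AE_I2) (auto simp: norm_mult intro!: mult_right_mono Im_log_quotient_bound)
  qed (use int in auto)
  then have "(LINT x|lborel. of_real (pi / 2) * (of_real (sgn (sin (pi * x))) * g x)) = 0"
    by (simp add: Im_0 LIMSEQ_const_iff mult.assoc)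
  then show ?thesis
    by (subst (asm) integral_mult_right_zero) auto
qed

section \<open>The extremal problem\<close>

lemma exp_type_le_times_id:
  assumes "exp_type_le \<tau> F"
  shows "exp_type_le \<tau> (\<lambda>z. z * F z)"
  unfolding exp_type_le_def
proof (intro allI impI)
  fix \<epsilon> :: real assume \<epsilon>: "0 < \<epsilon>"
  then obtain C where C: "norm (F z) \<le> C * exp ((\<tau> + \<epsilon> / 2) * norm z)" for z
    using assms unfolding exp_type_le_def by (meson half_gt_zero)
  have "norm (z * F z) \<le> 2 / \<epsilon> * C * exp ((\<tau> + \<epsilon>) * norm z)" for z
  proof -
    \<comment> \<open>Half of $\varepsilon$ absorbs the extra linear factor.\<close>
    have "\<epsilon> / 2 * norm z \<le> exp (\<epsilon> / 2 * norm z)"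
      using exp_ge_add_one_self[of "\<epsilon> / 2 * norm z"] by linarith
    then have "norm z \<le> 2 / \<epsilon> * exp (\<epsilon> / 2 * norm z)"
      using \<epsilon> by (simp add: field_simps)
    then have "norm (z * F z) \<le> (2 / \<epsilon> * exp (\<epsilon> / 2 * norm z)) * (C * exp ((\<tau> + \<epsilon> / 2) * norm z))"
      unfolding norm_mult using C[of z] \<epsilon> by (intro mult_mono) auto
    also have "\<dots> = 2 / \<epsilon> * C * (exp (\<epsilon> / 2 * norm z) * exp ((\<tau> + \<epsilon> / 2) * norm z))"
      by (simp only: mult_ac)
    also have "exp (\<epsilon> / 2 * norm z) * exp ((\<tau> + \<epsilon> / 2) * norm z) = exp ((\<tau> + \<epsilon>) * norm z)"
      by (simp add: mult_exp_exp algebra_simps)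
    finally show ?thesis .
  qed
  then show "\<exists>C. \<forall>z. norm (z * F z) \<le> C * exp ((\<tau> + \<epsilon>) * norm z)" by blast
qed

lemma has_integral_abs_indicator:
  "has_bochner_integral lborel (\<lambda>x::real. \<bar>x\<bar> * indicator {-1<..<1} x) 1"
proof -
  have "has_bochner_integral lborel (\<lambda>x::real. x * indicator {0..1} x) (1\<^sup>2 / 2 - 0\<^sup>2 / 2)"
    by (rule has_bochner_integral_FTC_Icc_real[where F = "\<lambda>x. x\<^sup>2 / 2"]) (auto intro!: derivative_eq_intros)
  moreover have "has_bochner_integral lborel (\<lambda>x::real. - x * indicator {-1..0} x) (- 0\<^sup>2 / 2 - - (-1)\<^sup>2 / 2)"
    by (rule has_bochner_integral_FTC_Icc_real[where F = "\<lambda>x. - x\<^sup>2 / 2"]) (auto intro!: derivative_eq_intros)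
  ultimately have "has_bochner_integral lborel (\<lambda>x::real. x * indicator {0..1} x + - x * indicator {-1..0} x)
      ((1\<^sup>2 / 2 - 0\<^sup>2 / 2) + (- 0\<^sup>2 / 2 - - (-1)\<^sup>2 / 2))"
    by (rule has_bochner_integral_add)
  then have "has_bochner_integral lborel (\<lambda>x::real. x * indicator {0..1} x + - x * indicator {-1..0} x) 1"
    by simp
  moreover have "AE x::real in lborel. x * indicator {0..1} x + - x * indicator {-1..0} x = \<bar>x\<bar> * indicator {-1<..<1} x"
    using AE_lborel_singleton[of "1::real"] AE_lborel_singleton[of "-1::real"]
    by eventually_elim (auto simp: indicator_def)
  ultimately show ?thesis
    by (subst (asm) has_bochner_integral_cong_AE) auto
qed

lemma abs_times_sgn_sin_indicator:
  "x * sgn (sin (pi * x)) * indicat_real {-1<..<1} x = \<bar>x\<bar> * indicator {-1<..<1} x"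
proof (cases "x \<in> {-1<..<1}")
  case True
  consider "x = 0" | "0 < x" "x < 1" | "0 < - x" "- x < 1"
    using True by fastforce
  then show ?thesis
  proof cases
    case 2
    then show ?thesis using sin_gt_zero[of "pi * x"] by simp
  next
    case 3
    then show ?thesis using sin_gt_zero[of "pi * - x"] mult_strict_left_mono[of "- x" 1 pi]
      by (simp add: mult_less_0_iff)
  qed simp
qed simp

theorem mainTheorem4: "best_approx_L1 pi (indicat_real {-1<..<1}) = 1"
proof -
  let ?\<chi> = "indicat_real {-1<..<1}"
  let ?f = "\<lambda>F. LINT x|abs_measure. norm (complex_of_real (?\<chi> x) - F (complex_of_real x))"
  have weight: "?f F = (LINT x|lborel. \<bar>x\<bar> * norm (of_real (?\<chi> x) - F (of_real x)))"
    if "(\<lambda>x. F (complex_of_real x)) \<in> borel_measurable borel" for F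
    using that unfolding abs_measure_def by (subst integral_density) auto
  have zero_mem: "(\<lambda>_. 0) \<in> exp_type_L1 pi"
    by (auto simp: exp_type_L1_def exp_type_le_def intro!: exI[of _ 0])
  have zero_val: "?f (\<lambda>_. 0) = 1"
    using has_integral_abs_indicator by (subst weight) (auto simp: has_bochner_integral_iff)
  have lower: "1 \<le> ?f F" if F: "F \<in> exp_type_L1 pi" for F
  proof -
    have hol: "F holomorphic_on UNIV" and type: "exp_type_le pi F"
      and int: "integrable abs_measure (\<lambda>x. F (of_real x))"
      using F by (auto simp: exp_type_L1_def)
    have [measurable]: "(\<lambda>x. F (complex_of_real x)) \<in> borel_measurable borel"
      using borel_measurable_integrable[OF int] by (simp add: abs_measure_def)
    have int_weight: "integrable lborel (\<lambda>x. \<bar>x\<bar> *\<^sub>R F (of_real x))"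
      using int unfolding abs_measure_def by (subst (asm) integrable_density) auto
    have int_G: "integrable lborel (\<lambda>x. of_real x * F (of_real x))"
      by (rule Bochner_Integration.integrable_bound[OF int_weight]) (auto simp: norm_mult)
    have "(LINT x|lborel. of_real (sgn (sin (pi * x))) * (of_real x * F (of_real x))) = 0"
      using hol by (intro integral_square_wave_eq_0 int_G
          fourier_integral_exp_type_eq_0[OF _ exp_type_le_times_id[OF type]] holomorphic_intros) auto
    moreover have int_SG: "integrable lborel (\<lambda>x. of_real (sgn (sin (pi * x))) * (of_real x * F (of_real x)))"
      by (rule Bochner_Integration.integrable_bound[OF int_G]) (auto simp: norm_mult sgn_if)
    moreover have \<chi>: "has_bochner_integral lborel (\<lambda>x. complex_of_real (\<bar>x\<bar> * ?\<chi> x)) (of_real 1)"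
      by (rule has_bochner_integral_of_real[OF has_integral_abs_indicator])
    ultimately have "(LINT x|lborel. complex_of_real (\<bar>x\<bar> * ?\<chi> x) - of_real (sgn (sin (pi * x))) * (of_real x * F (of_real x))) = 1"
      by (simp only: has_bochner_integral_iff Bochner_Integration.integral_diff) simp
    then have "1 = norm (LINT x|lborel. complex_of_real (\<bar>x\<bar> * ?\<chi> x) - of_real (sgn (sin (pi * x))) * (of_real x * F (of_real x)))"
      by simp
    also have "\<dots> \<le> (LINT x|lborel. \<bar>x\<bar> * norm (of_real (?\<chi> x) - F (of_real x)))"
    proof (rule order_trans[OF integral_norm_bound integral_mono])
      show "integrable lborel (\<lambda>x. norm (complex_of_real (\<bar>x\<bar> * ?\<chi> x) - of_real (sgn (sin (pi * x))) * (of_real x * F (of_real x))))"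
        using \<chi> int_SG by (auto simp: has_bochner_integral_iff)
      have "integrable lborel (\<lambda>x. norm (complex_of_real (\<bar>x\<bar> * ?\<chi> x) - \<bar>x\<bar> *\<^sub>R F (of_real x)))"
        using \<chi> int_weight by (auto simp: has_bochner_integral_iff)
      also have "(\<lambda>x. norm (complex_of_real (\<bar>x\<bar> * ?\<chi> x) - \<bar>x\<bar> *\<^sub>R F (of_real x))) = (\<lambda>x. \<bar>x\<bar> * norm (of_real (?\<chi> x) - F (of_real x)))"
      proof
        fix x
        have "complex_of_real (\<bar>x\<bar> * ?\<chi> x) - \<bar>x\<bar> *\<^sub>R F (of_real x) = \<bar>x\<bar> *\<^sub>R (of_real (?\<chi> x) - F (of_real x))"
          by (simp add: scaleR_conv_of_real algebra_simps)
        then show "norm (complex_of_real (\<bar>x\<bar> * ?\<chi> x) - \<bar>x\<bar> *\<^sub>R F (of_real x)) = \<bar>x\<bar> * norm (of_real (?\<chi> x) - F (of_real x))"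
          by (simp only: norm_scaleR abs_abs)
      qed
      finally show "integrable lborel (\<lambda>x. \<bar>x\<bar> * norm (of_real (?\<chi> x) - F (of_real x)))" .
      fix x
      have "complex_of_real (\<bar>x\<bar> * ?\<chi> x) - of_real (sgn (sin (pi * x))) * (of_real x * F (of_real x))
          = of_real (x * sgn (sin (pi * x))) * (of_real (?\<chi> x) - F (of_real x))"
        unfolding abs_times_sgn_sin_indicator[symmetric] by (simp add: algebra_simps)
      then show "norm (complex_of_real (\<bar>x\<bar> * ?\<chi> x) - of_real (sgn (sin (pi * x))) * (of_real x * F (of_real x)))
          \<le> \<bar>x\<bar> * norm (of_real (?\<chi> x) - F (of_real x))"
        by (simp add: norm_mult abs_mult sgn_if)
    qed
    finally show ?thesis by (simp add: weight)
  qed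
  show ?thesis
    unfolding best_approx_L1_def
    by (rule cInf_eq_minimum) (use zero_mem zero_val lower in force)+
qed

end
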